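(* Let $f:\mathbb{Z}^n\to\mathbb{R}\cup\{+\infty\}$ be a locally or globally discrete midpoint convex function, let $x\in\operatorname{dom} f$, and let $\{A_1,A_2,\ldots,A_m;B_1,B_2,\ldots,B_m\}$ be a multiset of subsets of $\{1,2,\ldots,n\}$ such that $A_1\subseteq A_2\subseteq\cdots\subseteq A_m$, $B_1\supseteq B_2\supseteq\cdots\supseteq B_m$, $A_m\cap B_1=\emptyset$, and $A_1\cup B_m\neq\emptyset$. Then for any bipartition $(I,J)$ of $\{1,2,\ldots,m\}$ (that is, $I\cap J=\emptyset$ and $I\cup J=\{1,2,\ldots,m\}$) we have $$f(x)+f(x+d_1+d_2)\ \ge\ f(x+d_1)+f(x+d_2),$$ where $d_1=\sum_{i\in I}(\mathbf{1}_{A_i}-\mathbf{1}_{B_i})$ and $d_2=\sum_{j\in J}(\mathbf{1}_{A_j}-\mathbf{1}_{B_j})$.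
   Context: For $x\in\mathbb{R}^n$, $\lceil x\rceil$ and $\lfloor x\rfloor$ denote the integer vectors obtained by rounding each component up, respectively down. For $A\subseteq\{1,\ldots,n\}$, $\mathbf{1}_A\in\{0,1\}^n$ is the characteristic vector of $A$. The effective domain of $f:\mathbb{Z}^n\to\mathbb{R}\cup\{+\infty\}$ is $\operatorname{dom} f=\{x\in\mathbb{Z}^n\mid f(x)<+\infty\}$. A set $S\subseteq\mathbb{Z}^n$ is discrete midpoint convex if for all $x,y\in S$ with $\|x-y\|_\infty\ge2$ both $\lceil (x+y)/2\rceil$ and $\lfloor (x+y)/2\rfloor$ belong to $S$. Discrete midpoint convexity inequality for a pair $(x,y)$: $f(x)+f(y)\ge f(\lceil (x+y)/2\rceil)+f(\lfloor (x+y)/2\rfloor)$. $f$ is globally discrete midpoint convex if this inequality holds for all $x,y\in\mathbb{Z}^n$ with $\|x-y\|_\infty\ge2$. $f$ is locally discrete midpoint convex if $\operatorname{dom} f$ is a discrete midpoint convex set and the inequality holds for all $x,y\in\mathbb{Z}^n$ with $\|x-y\|_\infty=2$. *)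

theory Defs
  imports "HOL-Analysis.Analysis"
begin

text \<open>The lattice Z^n is the type \<open>int ^ 'n\<close>; the ground set {1,...,n} is the
  universe of the finite index type \<open>'n\<close>. A function from Z^n to the reals extended by
  plus infinity is a function \<open>f :: int ^ 'n \<Rightarrow> ereal\<close> for which
  \<open>f x \<noteq> - \<infinity>\<close> everywhere is assumed separately, in the theorem.\<close>

definition real_vec :: "int ^ 'n \<Rightarrow> real ^ 'n" where
  "real_vec x = (\<chi> i. real_of_int (x $ i))"

definition vec_ceiling :: "real ^ 'n \<Rightarrow> int ^ 'n" where
  "vec_ceiling x = (\<chi> i. \<lceil>x $ i\<rceil>)"

definition vec_floor :: "real ^ 'n \<Rightarrow> int ^ 'n" where
  "vec_floor x = (\<chi> i. \<lfloor>x $ i\<rfloor>)"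

text \<open>The library's \<open>infnorm\<close> is only available on real Euclidean spaces.\<close>

definition linf_norm :: "int ^ 'n \<Rightarrow> int" where
  "linf_norm x = Max (range (\<lambda>i. \<bar>x $ i\<bar>))"

definition char_vec :: "'n set \<Rightarrow> int ^ 'n" where
  "char_vec A = (\<chi> i. indicator A i)"

definition eff_dom :: "(int ^ 'n \<Rightarrow> ereal) \<Rightarrow> (int ^ 'n) set" where
  "eff_dom f = {x. f x < \<infinity>}"

definition discrete_midpoint_convex_set :: "(int ^ 'n) set \<Rightarrow> bool" where
  "discrete_midpoint_convex_set S \<longleftrightarrow>
    (\<forall>x\<in>S. \<forall>y\<in>S. linf_norm (x - y) \<ge> 2 \<longrightarrow>
      vec_ceiling (midpoint (real_vec x) (real_vec y)) \<in> S \<and>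
      vec_floor (midpoint (real_vec x) (real_vec y)) \<in> S)"

definition discrete_midpoint_ineq ::
    "(int ^ 'n \<Rightarrow> ereal) \<Rightarrow> int ^ 'n \<Rightarrow> int ^ 'n \<Rightarrow> bool" where
  "discrete_midpoint_ineq f x y \<longleftrightarrow>
    f x + f y \<ge> f (vec_ceiling (midpoint (real_vec x) (real_vec y)))
                + f (vec_floor (midpoint (real_vec x) (real_vec y)))"

definition globally_discrete_midpoint_convex :: "(int ^ 'n \<Rightarrow> ereal) \<Rightarrow> bool" where
  "globally_discrete_midpoint_convex f \<longleftrightarrow>
    (\<forall>x y. linf_norm (x - y) \<ge> 2 \<longrightarrow> discrete_midpoint_ineq f x y)"

definition locally_discrete_midpoint_convex :: "(int ^ 'n \<Rightarrow> ereal) \<Rightarrow> bool" where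
  "locally_discrete_midpoint_convex f \<longleftrightarrow>
    discrete_midpoint_convex_set (eff_dom f) \<and>
    (\<forall>x y. linf_norm (x - y) = 2 \<longrightarrow> discrete_midpoint_ineq f x y)"

end

theory Submission
  imports Defs
begin

text \<open>
  Write \<open>d\<^sub>K = (\<Sum>k\<in>K. 1\<^sub>A\<^sub>k - 1\<^sub>B\<^sub>k)\<close> for a set \<open>K\<close> of indices. The inequality says that the set function
  \<open>\<phi> K = f (x + d\<^sub>K)\<close> satisfies \<open>\<phi> I + \<phi> J \<le> \<phi> {} + \<phi> (I \<union> J)\<close> for disjoint \<open>I\<close>, \<open>J\<close>, and this
  is an instance of supermodularity of \<open>\<phi>\<close>. A real-valued function on the subsets of a finite
  set is supermodular as soon as it is so on the squares \<open>K\<close>, \<open>K + i\<close>, \<open>K + j\<close>, \<open>K + i + j\<close> (\<open>supermodular_of_local\<close>). On such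
  a square with \<open>i < j\<close> the opposite corners have distance exactly 2, since the layers have an
  element in common, and because the sets \<open>A\<^sub>k\<close> increase and the sets \<open>B\<^sub>k\<close> decrease, rounding their
  midpoint up gives the corner \<open>K + j\<close> and rounding it down gives \<open>K + i\<close>. So the square
  inequality is the discrete midpoint inequality at distance 2 (\<open>square_inequality\<close>), which both
  local and global discrete midpoint convexity provide.

  What remains is finiteness of \<open>\<phi>\<close>: if \<open>x\<close> and \<open>x + d\<^sub>M\<close> lie in the discrete midpoint convex set
  \<open>S = dom f\<close>, where \<open>M\<close> is the full index set, then so does every \<open>x + d\<^sub>K\<close>
  (\<open>partial_signed_sum_mem\<close>). Adding the indices of \<open>K\<close> one at a time, it suffices to add a single
  layer. The layers are determined by the displacement \<open>v = d\<^sub>M\<close> of norm \<open>m\<close>: the \<open>k\<close>-th one has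
  \<open>A\<^sub>k = {v \<ge> m + 1 - k}\<close> and \<open>B\<^sub>k = {v \<le> - k}\<close>. That a single layer can be added is proved by
  induction on \<open>m\<close> (\<open>discrete_midpoint_convex_set_peelable\<close>).

  If \<open>m = 2 p\<close>, the roundings of \<open>v / 2\<close> have norm \<open>p\<close>; rounding up collects exactly the layers of
  \<open>v\<close> with even index and rounding down those with odd index, so the case \<open>p\<close> applies to each
  half. If \<open>m = 2 p + 1\<close>, rounding up takes the odd \<open>A\<^sub>k\<close> but the even \<open>B\<^sub>k\<close>, so the halves no longer
  consist of layers of \<open>v\<close>. It is enough, though, to find one index \<open>j\<close> for which layer \<open>j\<close> can be
  both added to \<open>x\<close> and subtracted from \<open>x + v\<close>, because the remaining layers are those of the
  displacement from \<open>x\<close> to \<open>x + v\<close> minus that layer, which has norm \<open>m - 1\<close>. An extreme layer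
  serves as \<open>j\<close> when \<open>v\<close> reaches only one of the values \<open>m\<close> and \<open>- m\<close>, and an even one serves when
  it reaches both.
\<close>

section \<open>Coordinatewise midpoints\<close>

definition half_up :: "int ^ 'n \<Rightarrow> int ^ 'n" where
  "half_up v = (\<chi> i. (v $ i + 1) div 2)"

definition half_down :: "int ^ 'n \<Rightarrow> int ^ 'n" where
  "half_down v = (\<chi> i. v $ i div 2)"

lemma half_down_add_half_up: "half_down v + half_up v = v"
proof -
  have "a div 2 + (a + 1) div 2 = a" for a :: int
    by presburger
  then show ?thesis
    by (simp add: half_down_def half_up_def vec_eq_iff)
qed

lemma half_up_minus: "half_up (- v) = - half_down v"
proof -
  have "(1 - a) div 2 = - (a div 2)" for a :: int
    by presburger
  then show ?thesis
    by (simp add: half_up_def half_down_def vec_eq_iff)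
qed

lemma midpoint_nth:
  "midpoint (real_vec x) (real_vec (x + v)) $ i = real_of_int (2 * x $ i + v $ i) / real_of_int 2"
  by (simp add: midpoint_def real_vec_def field_simps)

lemma vec_floor_midpoint:
  "vec_floor (midpoint (real_vec x) (real_vec (x + v))) = x + half_down v"
  unfolding vec_floor_def midpoint_nth floor_divide_of_int_eq
  by (simp add: half_down_def vec_eq_iff)

lemma vec_ceiling_midpoint:
  "vec_ceiling (midpoint (real_vec x) (real_vec (x + v))) = x + half_up v"
proof -
  have "- (- (2 * a + b) div 2) = a + (b + 1) div 2" for a b :: int
    by presburger
  then show ?thesis
    unfolding vec_ceiling_def midpoint_nth ceiling_divide_eq_div
    by (simp only: half_up_def vec_eq_iff vec_lambda_beta vector_add_component simp_thms)
qed

lemma linf_norm_eq_iff: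
  "linf_norm v = m \<longleftrightarrow> (\<forall>i. \<bar>v $ i\<bar> \<le> m) \<and> (\<exists>i. \<bar>v $ i\<bar> = m)"
  unfolding linf_norm_def by (subst Max_eq_iff) auto

lemma linf_norm_minus: "linf_norm (- v) = linf_norm v"
  by (simp add: linf_norm_def)

lemma discrete_midpoint_convex_setD:
  assumes "discrete_midpoint_convex_set S" "x \<in> S" "x + v \<in> S" "linf_norm v \<ge> 2"
  shows "x + half_up v \<in> S" "x + half_down v \<in> S"
proof -
  have "linf_norm (x - (x + v)) \<ge> 2"
    using assms(4) by (simp add: linf_norm_minus)
  then show "x + half_up v \<in> S" "x + half_down v \<in> S"
    using assms(1-3) unfolding discrete_midpoint_convex_set_def
    by (metis vec_ceiling_midpoint, metis vec_floor_midpoint)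
qed

section \<open>Layers of a displacement\<close>

text \<open>
  For \<open>m\<close> equal to the norm of \<open>v\<close> this is the \<open>k\<close>-th summand of the unique decomposition of \<open>v\<close>
  into \<open>m\<close> signed characteristic vectors whose positive parts increase with \<open>k\<close>, whose negative
  parts decrease with \<open>k\<close>, and where no positive part meets a negative one.
\<close>

definition layer :: "int \<Rightarrow> int \<Rightarrow> int ^ 'n \<Rightarrow> int ^ 'n" where
  "layer m k v = (\<chi> i. of_bool (v $ i \<ge> m + 1 - k) - of_bool (v $ i \<le> - k))"

text \<open>
  Walking from \<open>x + v\<close> back to \<open>x\<close> meets the same layers in the opposite order. Statements about
  adding layers to the lower end thereby yield statements about subtracting them from the upper end.
\<close>

lemma layer_minus: "layer m k (- v) = - layer m (m + 1 - k) v"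
  by (auto simp: layer_def vec_eq_iff)

definition peelable :: "(int ^ 'n) set \<Rightarrow> int \<Rightarrow> bool" where
  "peelable S m \<longleftrightarrow> (\<forall>x v k. x \<in> S \<longrightarrow> x + v \<in> S \<longrightarrow> linf_norm v = m \<longrightarrow>
     1 \<le> k \<longrightarrow> k \<le> m \<longrightarrow> x + layer m k v \<in> S)"

lemma peelableD:
  assumes "peelable S m" "x \<in> S" "x + v \<in> S" "linf_norm v = m" "1 \<le> k" "k \<le> m"
  shows "x + layer m k v \<in> S"
  using assms unfolding peelable_def by blast

lemma peelableD_top:
  assumes "peelable S m" "x \<in> S" "x + v \<in> S" "linf_norm v = m" "1 \<le> k" "k \<le> m"
  shows "x + v - layer m k v \<in> S"
  using peelableD[of S m "x + v" "- v" "m + 1 - k"] assms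
  by (simp add: linf_norm_minus layer_minus)

lemma layer_one:
  assumes "linf_norm v = 1"
  shows "layer 1 1 v = v"
proof -
  have "\<bar>v $ i\<bar> \<le> 1" for i
    using assms by (simp add: linf_norm_eq_iff)
  then have "v $ i = -1 \<or> v $ i = 0 \<or> v $ i = 1" for i
    by (smt (verit))
  then show ?thesis
    by (auto simp: layer_def vec_eq_iff) (smt (verit))+
qed

lemma peelable_1:
  fixes S :: "(int ^ 'n) set"
  shows "peelable S 1"
  unfolding peelable_def
proof (intro allI impI)
  fix x v :: "int ^ 'n" and k :: int
  assume "x + v \<in> S" "linf_norm v = 1" "1 \<le> k" "k \<le> 1"
  moreover from this have "k = 1" by linarith
  ultimately show "x + layer 1 k v \<in> S"
    by (simp add: layer_one)
qed

text \<open>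
  The next two lemmas identify the layers of a rounded half as every other layer of the doubled
  norm.
\<close>

lemma layer_half_up: "layer p j (half_up v) = layer (2 * p) (2 * j) v"
proof -
  have "p + 1 - j \<le> (a + 1) div 2 \<longleftrightarrow> 2 * p + 1 - 2 * j \<le> a"
    "(a + 1) div 2 \<le> - j \<longleftrightarrow> a \<le> - (2 * j)" for a :: int
    by presburger+
  then show ?thesis
    by (simp add: layer_def half_up_def vec_eq_iff)
qed

lemma layer_half_down: "layer p j (half_down v) = layer (2 * p) (2 * j - 1) v"
proof -
  have "p + 1 - j \<le> a div 2 \<longleftrightarrow> 2 * p + 1 - (2 * j - 1) \<le> a"
    "a div 2 \<le> - j \<longleftrightarrow> a \<le> - (2 * j - 1)" for a :: int
    by presburger+
  then show ?thesis
    by (simp add: layer_def half_down_def vec_eq_iff)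
qed

lemma peelable_even:
  assumes S: "discrete_midpoint_convex_set S" and p: "p \<ge> 1" "peelable S p"
  shows "peelable S (2 * p)"
  unfolding peelable_def
proof (intro allI impI)
  fix x v k
  assume x: "x \<in> S" "x + v \<in> S" and v: "linf_norm v = 2 * p" and k: "1 \<le> k" "k \<le> 2 * p"
  note mid = discrete_midpoint_convex_setD[OF S x]
  have "\<bar>v $ i\<bar> \<le> 2 * p" for i
    using v by (simp add: linf_norm_eq_iff)
  moreover obtain i where "\<bar>v $ i\<bar> = 2 * p"
    using v by (auto simp: linf_norm_eq_iff)
  moreover have "\<bar>(a + 1) div 2\<bar> \<le> p" "\<bar>a div 2\<bar> \<le> p" if "\<bar>a\<bar> \<le> 2 * p" for a
    using that by presburger+
  moreover have "\<bar>(a + 1) div 2\<bar> = p" "\<bar>a div 2\<bar> = p" if "\<bar>a\<bar> = 2 * p" for a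
    using that by presburger+
  ultimately have n: "linf_norm (half_up v) = p" "linf_norm (half_down v) = p"
    unfolding linf_norm_eq_iff half_up_def half_down_def by (auto intro!: exI[of _ i])
  show "x + layer (2 * p) k v \<in> S"
  proof (cases "even k")
    case True
    then obtain j where "k = 2 * j" by blast
    then show ?thesis
      using peelableD[OF p(2) x(1) mid(1) n(1), of j] v p k by (simp add: layer_half_up)
  next
    case False
    then obtain j where "k = 2 * j + 1" by (elim oddE)
    then show ?thesis
      using peelableD[OF p(2) x(1) mid(2) n(2), of "j + 1"] v p k
      by (simp add: layer_half_down add.commute)
  qed
qed

text \<open>
  A coordinate of absolute value \<open>m\<close> belongs to every layer, with its own sign, so removing any
  single layer brings it down to \<open>m - 1\<close>.
\<close>

lemma linf_norm_diff_layer: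
  assumes "linf_norm v = m" "1 \<le> j" "j \<le> m"
  shows "linf_norm (v - layer m j v) = m - 1"
proof -
  let ?g = "\<lambda>a :: int. a - (of_bool (a \<ge> m + 1 - j) - of_bool (a \<le> - j))"
  have g: "\<bar>a\<bar> \<le> m \<Longrightarrow> \<bar>?g a\<bar> \<le> m - 1" "\<bar>a\<bar> = m \<Longrightarrow> \<bar>?g a\<bar> = m - 1" for a
    using assms(2,3) by (auto simp: of_bool_def)
  have "(v - layer m j v) $ i = ?g (v $ i)" for i
    by (simp add: layer_def)
  then show ?thesis
    using assms(1) g unfolding linf_norm_eq_iff by metis
qed

lemma layer_diff_layer:
  assumes "1 \<le> j" "j \<le> m" "1 \<le> k" "k \<le> m" "k \<noteq> j"
  shows "layer (m - 1) (if k < j then k else k - 1) (v - layer m j v) = layer m k v"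
  using assms by (auto simp: layer_def vec_eq_iff)

text \<open>
  The induction step for odd norm: from one layer that can be removed at both ends, the others
  follow. Removing it at the upper end leaves a displacement of norm \<open>m - 1\<close> that starts at \<open>x\<close>
  and consists of the other layers.
\<close>

lemma layers_of_one_layer:
  assumes "peelable S (m - 1)" "linf_norm v = m" "1 \<le> j" "j \<le> m"
    and "x \<in> S" "x + layer m j v \<in> S" "x + v - layer m j v \<in> S"
    and "1 \<le> k" "k \<le> m"
  shows "x + layer m k v \<in> S"
proof (cases "k = j")
  case False
  have "x + (v - layer m j v) \<in> S"
    using assms(7) by (simp add: algebra_simps)
  from peelableD[OF assms(1) assms(5) this linf_norm_diff_layer[OF assms(2-4)],
      of "if k < j then k else k - 1"]
  show ?thesis
    using layer_diff_layer[of j m k v] assms False by (auto split: if_splits)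
qed (use assms in simp)

lemma linf_norm_half_up:
  assumes "linf_norm v = 2 * p + 1" "v $ i = 2 * p + 1"
  shows "linf_norm (half_up v) = p + 1"
proof -
  have *: "\<bar>(a + 1) div 2\<bar> \<le> p + 1" if "\<bar>a\<bar> \<le> 2 * p + 1" for a
    using that by presburger
  have "\<bar>v $ j\<bar> \<le> 2 * p + 1" for j
    using assms(1) by (simp add: linf_norm_eq_iff)
  with * have "\<bar>half_up v $ j\<bar> \<le> p + 1" for j
    by (simp add: half_up_def)
  moreover have "\<bar>half_up v $ i\<bar> = p + 1"
    using assms(2) calculation[of i] by (simp add: half_up_def)
  ultimately show ?thesis
    unfolding linf_norm_eq_iff by blast
qed

lemma linf_norm_half_down:
  assumes "linf_norm v = 2 * p + 1" "v $ i = - (2 * p + 1)"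
  shows "linf_norm (half_down v) = p + 1"
  using linf_norm_half_up[of "- v" p i] assms by (simp add: half_up_minus linf_norm_minus)

text \<open>
  If no coordinate equals \<open>- m\<close> for \<open>m = 2 p + 1\<close>, the last layer of \<open>v\<close> is the indicator of its positive
  coordinates. It is also the last layer of the half rounded up, since that half has norm \<open>p + 1\<close>,
  attained only on the positive side. The lemma that follows is the mirror image.
\<close>

lemma last_layer_odd:
  assumes S: "discrete_midpoint_convex_set S" and p: "p \<ge> 1" "peelable S (p + 1)"
    and x: "x \<in> S" "x + v \<in> S" and v: "linf_norm v = 2 * p + 1"
    and one_sided: "\<And>i. v $ i \<noteq> - (2 * p + 1)"
  shows "x + layer (2 * p + 1) (2 * p + 1) v \<in> S"
proof -
  have bound: "\<bar>v $ i\<bar> \<le> 2 * p + 1" for i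
    using v by (simp add: linf_norm_eq_iff)
  obtain i where "\<bar>v $ i\<bar> = 2 * p + 1"
    using v by (auto simp: linf_norm_eq_iff)
  then have "v $ i = 2 * p + 1"
    using one_sided[of i] by linarith
  then have "linf_norm (half_up v) = p + 1"
    by (rule linf_norm_half_up[OF v])
  moreover have "x + half_up v \<in> S"
    using discrete_midpoint_convex_setD(1)[OF S x] v p(1) by simp
  moreover have "layer (p + 1) (p + 1) (half_up v) = layer (2 * p + 1) (2 * p + 1) v"
  proof -
    have "1 \<le> (a + 1) div 2 \<longleftrightarrow> 1 \<le> a" "\<not> (a + 1) div 2 \<le> - (p + 1)" "\<not> a \<le> - (2 * p + 1)"
      if "\<bar>a\<bar> \<le> 2 * p + 1" "a \<noteq> - (2 * p + 1)" for a
      using that by presburger+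
    with bound one_sided show ?thesis
      by (simp add: layer_def half_up_def vec_eq_iff)
  qed
  ultimately show ?thesis
    using peelableD[OF p(2) x(1), of "half_up v" "p + 1"] p(1) by simp
qed

lemma first_layer_odd:
  assumes S: "discrete_midpoint_convex_set S" and p: "p \<ge> 1" "peelable S (p + 1)"
    and x: "x \<in> S" "x + v \<in> S" and v: "linf_norm v = 2 * p + 1"
    and one_sided: "\<And>i. v $ i \<noteq> 2 * p + 1"
  shows "x + layer (2 * p + 1) 1 v \<in> S"
proof -
  have bound: "\<bar>v $ i\<bar> \<le> 2 * p + 1" for i
    using v by (simp add: linf_norm_eq_iff)
  obtain i where "\<bar>v $ i\<bar> = 2 * p + 1"
    using v by (auto simp: linf_norm_eq_iff)
  then have "v $ i = - (2 * p + 1)"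
    using one_sided[of i] by linarith
  then have "linf_norm (half_down v) = p + 1"
    by (rule linf_norm_half_down[OF v])
  moreover have "x + half_down v \<in> S"
    using discrete_midpoint_convex_setD(2)[OF S x] v p(1) by simp
  moreover have "layer (p + 1) 1 (half_down v) = layer (2 * p + 1) 1 v"
  proof -
    have *: "a div 2 \<le> - 1 \<longleftrightarrow> a \<le> - 1" "\<not> p + 1 \<le> a div 2" "\<not> 2 * p + 1 \<le> a"
      if "\<bar>a\<bar> \<le> 2 * p + 1" "a \<noteq> 2 * p + 1" for a
      using that by presburger+
    have "layer (p + 1) 1 (half_down v) $ i = layer (2 * p + 1) 1 v $ i" for i
      using *[OF bound[of i] one_sided[of i]] by (simp add: layer_def half_down_def)
    then show ?thesis
      by (simp add: vec_eq_iff)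
  qed
  ultimately show ?thesis
    using peelableD[OF p(2) x(1), of "half_down v" 1] p(1) by simp
qed

text \<open>
  Now \<open>v\<close> reaches both \<open>m\<close> and \<open>- m\<close> for \<open>m = 2 p + 1\<close>. The displacement from \<open>x + half_up v\<close> to \<open>x + v\<close> has norm
  \<open>p + 1\<close>, and its first layer is minus the indicator of the negative coordinates of \<open>v\<close>.
  Subtracting it from \<open>x + v\<close> moves every negative coordinate one step towards 0: this gives a
  displacement \<open>w\<close> that still has norm \<open>2 p + 1\<close>, but whose half rounded down consists exactly of
  the layers of \<open>v\<close> with even index.
\<close>

lemma even_layer_odd:
  assumes S: "discrete_midpoint_convex_set S"
    and p: "p \<ge> 1" "peelable S p" "peelable S (p + 1)"
    and x: "x \<in> S" "x + v \<in> S" and v: "linf_norm v = 2 * p + 1"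
    and two_sided: "v $ i = 2 * p + 1" "v $ i' = - (2 * p + 1)"
    and j: "1 \<le> j" "j \<le> p"
  shows "x + layer (2 * p + 1) (2 * j) v \<in> S"
proof -
  have bound: "\<bar>v $ l\<bar> \<le> 2 * p + 1" for l
    using v by (simp add: linf_norm_eq_iff)
  define w where "w = (\<chi> l. v $ l + of_bool (v $ l \<le> - 1))"
  have "x + half_up v \<in> S"
    using discrete_midpoint_convex_setD(1)[OF S x] v p(1) by simp
  moreover have eq: "x + half_up v + half_down v = x + v"
    using half_down_add_half_up[of v] by (simp add: algebra_simps)
  moreover have "linf_norm (half_down v) = p + 1"
    by (rule linf_norm_half_down[OF v two_sided(2)])
  ultimately have "x + v - layer (p + 1) 1 (half_down v) \<in> S"
    using peelableD_top[OF p(3), of "x + half_up v" "half_down v" 1] x(2) p(1)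
    unfolding eq by simp
  moreover have "x + v - layer (p + 1) 1 (half_down v) = x + w"
  proof -
    have *: "\<not> p + 1 \<le> a div 2" "a div 2 \<le> - 1 \<longleftrightarrow> a \<le> - 1" if "\<bar>a\<bar> \<le> 2 * p + 1" for a
      using that by presburger+
    have "(x + v - layer (p + 1) 1 (half_down v)) $ l = (x + w) $ l" for l
      using *[OF bound[of l]] by (simp add: w_def layer_def half_down_def)
    then show ?thesis
      by (simp add: vec_eq_iff)
  qed
  ultimately have "x + w \<in> S"
    by simp
  moreover have "linf_norm w = 2 * p + 1"
  proof -
    have "\<bar>w $ l\<bar> \<le> 2 * p + 1" for l
      using bound[of l] by (auto simp: w_def)
    moreover have "\<bar>w $ i\<bar> = 2 * p + 1"
      using two_sided(1) p(1) by (simp add: w_def)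
    ultimately show ?thesis
      unfolding linf_norm_eq_iff by blast
  qed
  ultimately have "x + half_down w \<in> S"
    using discrete_midpoint_convex_setD(2)[OF S x(1)] p(1) by simp
  moreover have half_w: "half_down w $ l = (if v $ l \<le> - 1 then (v $ l + 1) div 2 else v $ l div 2)"
    for l
    by (simp add: w_def half_down_def)
  have "linf_norm (half_down w) = p"
  proof -
    have "\<bar>if a \<le> - 1 then (a + 1) div 2 else a div 2\<bar> \<le> p" if "\<bar>a\<bar> \<le> 2 * p + 1" for a
    proof (cases "a \<le> - 1")
      case True
      with that have "\<bar>(a + 1) div 2\<bar> \<le> p" by presburger
      with True show ?thesis by simp
    next
      case False
      with that have "\<bar>a div 2\<bar> \<le> p" by presburger
      with False show ?thesis by simp
    qed
    with bound have "\<bar>half_down w $ l\<bar> \<le> p" for l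
      unfolding half_w by blast
    moreover have "\<bar>half_down w $ i\<bar> = p"
      using two_sided(1) p(1) by (simp add: half_w)
    ultimately show ?thesis
      unfolding linf_norm_eq_iff by blast
  qed
  moreover have "layer p j (half_down w) = layer (2 * p + 1) (2 * j) v"
  proof -
    have neg: "\<not> p + 1 - j \<le> (a + 1) div 2" "\<not> 2 * p + 1 + 1 - 2 * j \<le> a"
      "(a + 1) div 2 \<le> - j \<longleftrightarrow> a \<le> - (2 * j)" if "a \<le> - 1" for a
      using j that by presburger+
    have pos: "p + 1 - j \<le> a div 2 \<longleftrightarrow> 2 * p + 1 + 1 - 2 * j \<le> a"
      "\<not> a div 2 \<le> - j" "\<not> a \<le> - (2 * j)" if "\<not> a \<le> - 1" for a
      using j that by presburger+
    have "layer p j (half_down w) $ l = layer (2 * p + 1) (2 * j) v $ l" for l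
      unfolding layer_def vec_lambda_beta half_w
      by (cases "v $ l \<le> - 1") (simp_all only: if_True if_False neg pos simp_thms)
    then show ?thesis
      by (simp add: vec_eq_iff)
  qed
  ultimately show ?thesis
    using peelableD[OF p(2) x(1), of "half_down w" j] j by simp
qed

lemma peelable_odd:
  assumes S: "discrete_midpoint_convex_set S"
    and p: "p \<ge> 1" "peelable S p" "peelable S (p + 1)" "peelable S (2 * p)"
  shows "peelable S (2 * p + 1)"
  unfolding peelable_def
proof (intro allI impI)
  fix x v k
  assume x: "x \<in> S" "x + v \<in> S" and v: "linf_norm v = 2 * p + 1"
    and k: "1 \<le> k" "k \<le> 2 * p + 1"
  let ?m = "2 * p + 1"
  have rev: "x + v \<in> S" "x + v + - v \<in> S" "linf_norm (- v) = ?m"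
    using x v by (simp_all add: linf_norm_minus)
  have "\<exists>j. 1 \<le> j \<and> j \<le> ?m \<and> x + layer ?m j v \<in> S \<and> x + v - layer ?m j v \<in> S"
  proof (cases "\<exists>i. v $ i = - ?m")
    case False
    then have "x + layer ?m ?m v \<in> S"
      by (intro last_layer_odd[OF S p(1,3) x v]) auto
    moreover have "(- v) $ i \<noteq> ?m" for i
      using False by (metis minus_minus vector_uminus_component)
    then have "x + v + layer ?m 1 (- v) \<in> S"
      by (rule first_layer_odd[OF S p(1,3) rev])
    \<comment> \<open>seen from the upper end, the first layer of \<open>- v\<close> is the last layer of \<open>v\<close>\<close>
    ultimately show ?thesis
      using p(1) by (intro exI[of _ ?m]) (simp add: layer_minus add.commute)
  next
    case neg: True
    show ?thesis
    proof (cases "\<exists>i. v $ i = ?m")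
      case False
      then have "x + layer ?m 1 v \<in> S"
        by (intro first_layer_odd[OF S p(1,3) x v]) auto
      moreover have "(- v) $ i \<noteq> - ?m" for i
        using False by (metis minus_minus vector_uminus_component)
      then have "x + v + layer ?m ?m (- v) \<in> S"
        by (rule last_layer_odd[OF S p(1,3) rev])
      ultimately show ?thesis
        using p(1) by (intro exI[of _ 1]) (simp add: layer_minus)
    next
      case True
      then obtain i i' where i: "v $ i = ?m" "v $ i' = - ?m"
        using neg by blast
      \<comment> \<open>\<open>2 * p\<close> is even, and so is its reversed index \<open>?m + 1 - 2 * p = 2\<close>\<close>
      have "x + layer ?m (2 * p) v \<in> S"
        using even_layer_odd[OF S p(1-3) x v i, of p] p(1) by simp
      moreover have "x + v + layer ?m (2 * 1) (- v) \<in> S"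
        using i p(1) by (intro even_layer_odd[OF S p(1-3) rev, of i' i]) auto
      ultimately show ?thesis
        using p(1) by (intro exI[of _ "2 * p"]) (simp add: layer_minus)
    qed
  qed
  then show "x + layer ?m k v \<in> S"
    using layers_of_one_layer[OF _ v _ _ x(1) _ _ k] p(4) by auto
qed

lemma discrete_midpoint_convex_set_peelable:
  assumes "discrete_midpoint_convex_set S"
  shows "peelable S (int m)"
proof (induction m rule: less_induct)
  case (less m)
  consider "m = 0" | "m = 1" | p where "p \<ge> 1" "m = 2 * p" | p where "p \<ge> 1" "m = 2 * p + 1"
    by (cases "even m") (auto elim!: evenE oddE, force+)
  then show ?case
  proof cases
    case 1
    then show ?thesis by (simp add: peelable_def)
  next
    case 2
    then show ?thesis using peelable_1 by simp
  next
    case 3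
    then show ?thesis
      using peelable_even[OF assms, of "int p"] less.IH[of p] by simp
  next
    case 4
    then show ?thesis
      using peelable_odd[OF assms, of "int p"] less.IH[of p] less.IH[of "p + 1"] less.IH[of "2 * p"]
      by (simp add: algebra_simps)
  qed
qed

section \<open>Chains of signed sets\<close>

definition signed_sum :: "(nat \<Rightarrow> 'n set) \<Rightarrow> (nat \<Rightarrow> 'n set) \<Rightarrow> nat set \<Rightarrow> int ^ 'n" where
  "signed_sum A B K = (\<Sum>k\<in>K. char_vec (A k) - char_vec (B k))"

text \<open>
  The index set is an arbitrary finite set of natural numbers, so that an index can be dropped
  without renumbering the others. The point \<open>c\<close> lies in every layer with a constant sign; it makes
  the norm of the total displacement equal to the number of layers.
\<close>

locale signed_chain =
  fixes M :: "nat set" and A B :: "nat \<Rightarrow> 'n::finite set" and c :: 'n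
  assumes finite_M: "finite M"
    and A_mono: "\<And>k l. k \<in> M \<Longrightarrow> l \<in> M \<Longrightarrow> k \<le> l \<Longrightarrow> A k \<subseteq> A l"
    and B_antimono: "\<And>k l. k \<in> M \<Longrightarrow> l \<in> M \<Longrightarrow> k \<le> l \<Longrightarrow> B l \<subseteq> B k"
    and disjoint: "\<And>k l. k \<in> M \<Longrightarrow> l \<in> M \<Longrightarrow> A k \<inter> B l = {}"
    and common: "(\<forall>k\<in>M. c \<in> A k) \<or> (\<forall>k\<in>M. c \<in> B k)"
begin

lemma signed_chain_subset:
  assumes "N \<subseteq> M"
  shows "signed_chain N A B c"
proof
  show "finite N"
    using assms finite_M by (rule finite_subset)
  show "A k \<subseteq> A l" if "k \<in> N" "l \<in> N" "k \<le> l" for k l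
    using that assms by (intro A_mono) auto
  show "B l \<subseteq> B k" if "k \<in> N" "l \<in> N" "k \<le> l" for k l
    using that assms by (intro B_antimono) auto
  show "A k \<inter> B l = {}" if "k \<in> N" "l \<in> N" for k l
    using that assms by (intro disjoint) auto
  show "(\<forall>k\<in>N. c \<in> A k) \<or> (\<forall>k\<in>N. c \<in> B k)"
    using common assms by fast
qed

lemma signed_sum_nth:
  "signed_sum A B M $ i = int (card {k \<in> M. i \<in> A k}) - int (card {k \<in> M. i \<in> B k})"
proof -
  have "(\<Sum>k\<in>M. indicator (C k) i :: int) = int (card {k \<in> M. i \<in> C k})" for C :: "nat \<Rightarrow> 'n set"
    using finite_M by (simp add: indicator_def sum_of_bool_eq Int_def)
  then show ?thesis
    by (simp add: signed_sum_def char_vec_def sum_subtractf)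
qed

lemma nth_pos:
  assumes "i \<in> A k" "k \<in> M"
  shows "signed_sum A B M $ i = int (card {k \<in> M. i \<in> A k})"
proof -
  have "{k \<in> M. i \<in> B k} = {}"
    using disjoint assms by blast
  then have "card {k \<in> M. i \<in> B k} = 0"
    by (simp only: card.empty)
  then show ?thesis
    by (simp add: signed_sum_nth)
qed

lemma nth_neg:
  assumes "i \<in> B k" "k \<in> M"
  shows "signed_sum A B M $ i = - int (card {k \<in> M. i \<in> B k})"
proof -
  have "{k \<in> M. i \<in> A k} = {}"
    using disjoint assms by blast
  then have "card {k \<in> M. i \<in> A k} = 0"
    by (simp only: card.empty)
  then show ?thesis
    by (simp add: signed_sum_nth)
qed

lemma linf_norm_signed_sum: "linf_norm (signed_sum A B M) = int (card M)"
proof -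
  have "\<bar>signed_sum A B M $ i\<bar> \<le> int (card M)" for i
    using card_mono[OF finite_M, of "{k \<in> M. i \<in> A k}"]
      card_mono[OF finite_M, of "{k \<in> M. i \<in> B k}"]
    unfolding signed_sum_nth by auto
  moreover have "\<bar>signed_sum A B M $ c\<bar> = int (card M)"
  proof (cases "M = {}")
    case True
    then show ?thesis by (simp add: signed_sum_def)
  next
    case False
    then obtain k where k: "k \<in> M" by blast
    show ?thesis
      using common
    proof
      assume "\<forall>k\<in>M. c \<in> A k"
      moreover from this have "{k \<in> M. c \<in> A k} = M" by blast
      ultimately show ?thesis using nth_pos[of c k] k by simp
    next
      assume "\<forall>k\<in>M. c \<in> B k"
      moreover from this have "{k \<in> M. c \<in> B k} = M" by blast
      ultimately show ?thesis using nth_neg[of c k] k by simp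
    qed
  qed
  ultimately show ?thesis
    unfolding linf_norm_eq_iff by blast
qed

text \<open>
  By nestedness the indices \<open>k\<close> with \<open>i \<in> A\<^sub>k\<close> form an upper segment of \<open>M\<close> and those with \<open>i \<in> B\<^sub>k\<close> a
  lower segment, so the value of the sum at \<open>i\<close>, which counts the segment, tells whether it
  reaches \<open>j\<close>. The layer number of \<open>j\<close> is its rank in \<open>M\<close>.
\<close>

lemma layer_signed_sum:
  assumes "j \<in> M"
  shows "layer (int (card M)) (int (card {k \<in> M. k \<le> j})) (signed_sum A B M)
    = char_vec (A j) - char_vec (B j)"
proof -
  let ?m = "int (card M)" and ?r = "int (card {k \<in> M. k \<le> j})" and ?v = "signed_sum A B M"
  have "M = {k \<in> M. k \<le> j} \<union> {k \<in> M. j < k}"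
    by auto
  then have "card M = card {k \<in> M. k \<le> j} + card {k \<in> M. j < k}"
    using finite_M card_Un_disjoint[of "{k \<in> M. k \<le> j}" "{k \<in> M. j < k}"] by fastforce
  then have above: "?m - ?r = int (card {k \<in> M. j < k})"
    by simp
  have pos: "?m + 1 - ?r \<le> ?v $ i \<longleftrightarrow> i \<in> A j" for i
  proof
    assume "i \<in> A j"
    then have "insert j {k \<in> M. j < k} \<subseteq> {k \<in> M. i \<in> A k}"
      using A_mono[OF assms] assms by (auto dest: less_imp_le)
    then have "card (insert j {k \<in> M. j < k}) \<le> card {k \<in> M. i \<in> A k}"
      using finite_M by (intro card_mono) auto
    then show "?m + 1 - ?r \<le> ?v $ i"
      using above finite_M nth_pos[OF \<open>i \<in> A j\<close> assms] by simp
  next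
    assume *: "?m + 1 - ?r \<le> ?v $ i"
    show "i \<in> A j"
    proof (rule ccontr)
      assume "i \<notin> A j"
      then have "j < k" if "k \<in> M" "i \<in> A k" for k
        using A_mono[of k j] that assms by (cases "k \<le> j") auto
      then have "{k \<in> M. i \<in> A k} \<subseteq> {k \<in> M. j < k}"
        by auto
      then have "card {k \<in> M. i \<in> A k} \<le> card {k \<in> M. j < k}"
        using finite_M by (intro card_mono) auto
      then show False
        using * above unfolding signed_sum_nth by linarith
    qed
  qed
  have neg: "?v $ i \<le> - ?r \<longleftrightarrow> i \<in> B j" for i
  proof
    assume "i \<in> B j"
    then have "{k \<in> M. k \<le> j} \<subseteq> {k \<in> M. i \<in> B k}"
      using B_antimono[OF _ assms] by auto
    then have "card {k \<in> M. k \<le> j} \<le> card {k \<in> M. i \<in> B k}"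
      using finite_M by (intro card_mono) auto
    then show "?v $ i \<le> - ?r"
      using nth_neg[OF \<open>i \<in> B j\<close> assms] by simp
  next
    assume *: "?v $ i \<le> - ?r"
    show "i \<in> B j"
    proof (rule ccontr)
      assume "i \<notin> B j"
      then have "k < j" if "k \<in> M" "i \<in> B k" for k
        using B_antimono[of j k] that assms by (cases "j \<le> k") auto
      then have "{k \<in> M. i \<in> B k} \<subseteq> {k \<in> M. k \<le> j}"
        by (auto dest: less_imp_le)
      moreover have "j \<in> {k \<in> M. k \<le> j}" "j \<notin> {k \<in> M. i \<in> B k}"
        using assms \<open>i \<notin> B j\<close> by simp_all
      ultimately have "{k \<in> M. i \<in> B k} \<subset> {k \<in> M. k \<le> j}"
        by (metis psubsetI)
      then have "card {k \<in> M. i \<in> B k} < card {k \<in> M. k \<le> j}"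
        using finite_M by (intro psubset_card_mono) auto
      then show False
        using * unfolding signed_sum_nth by linarith
    qed
  qed
  show ?thesis
    using pos neg by (simp add: layer_def char_vec_def vec_eq_iff indicator_def)
qed

end

lemma signed_sum_insert:
  assumes "finite K" "k \<notin> K"
  shows "signed_sum A B (insert k K) = (char_vec (A k) - char_vec (B k)) + signed_sum A B K"
  using assms by (simp add: signed_sum_def)

text \<open>
  Once one layer has been added, the rest of \<open>K\<close> belongs to the shorter chain \<open>M - {j}\<close> that leads
  from the new point to the same end point.
\<close>

lemma (in signed_chain) partial_signed_sum_mem:
  assumes S: "discrete_midpoint_convex_set S"
    and "x \<in> S" "x + signed_sum A B M \<in> S" "K \<subseteq> M"
  shows "x + signed_sum A B K \<in> S"
proof -
  have "finite K"
    using assms(4) finite_M finite_subset by blast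
  then show ?thesis
    using signed_chain_axioms assms(2-4)
  proof (induction K arbitrary: x M rule: finite_induct)
    case empty
    then show ?case by (simp add: signed_sum_def)
  next
    case (insert j K)
    interpret N: signed_chain M A B c by (rule insert.prems)
    let ?d = "char_vec (A j) - char_vec (B j)"
    have j: "j \<in> M" using insert.prems by simp
    have "{k \<in> M. k \<le> j} \<subseteq> M" "j \<in> {k \<in> M. k \<le> j}"
      using j by auto
    then have "card {k \<in> M. k \<le> j} \<le> card M" "0 < card {k \<in> M. k \<le> j}"
      using N.finite_M card_mono card_gt_0_iff[of "{k \<in> M. k \<le> j}"] by (blast, auto)
    then have "x + ?d \<in> S"
      using peelableD[OF discrete_midpoint_convex_set_peelable[OF S] insert.prems(2,3)
          N.linf_norm_signed_sum, of "int (card {k \<in> M. k \<le> j})"]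
      by (simp add: N.layer_signed_sum[OF j])
    moreover have "x + ?d + signed_sum A B (M - {j}) = x + signed_sum A B M"
      using signed_sum_insert[of "M - {j}" j A B] j N.finite_M by (simp add: insert_absorb add.assoc)
    then have "x + ?d + signed_sum A B (M - {j}) \<in> S"
      using insert.prems(3) by (simp only:)
    moreover have "K \<subseteq> M - {j}"
      using insert.prems(4) insert.hyps(2) by blast
    moreover have "signed_chain (M - {j}) A B c"
      by (rule N.signed_chain_subset) blast
    ultimately have "x + ?d + signed_sum A B K \<in> S"
      by (intro insert.IH[of "M - {j}" "x + ?d"])
    then show ?case
      using insert.hyps by (simp add: signed_sum_insert add.assoc)
  qed
qed

section \<open>From squares to parallelograms\<close>

text \<open>
  The rectangle spanned by \<open>I\<close> and \<open>J\<close> is tiled by squares. Adding the inequalities of a row, and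
  then those of the rows, all interior corners cancel, because the values lie in a group.
\<close>

lemma supermodular_of_local:
  fixes \<phi> :: "'a set \<Rightarrow> 'b::ordered_ab_group_add"
  assumes loc: "\<And>K i j. K \<subseteq> M \<Longrightarrow> i \<in> M - K \<Longrightarrow> j \<in> M - K \<Longrightarrow> i \<noteq> j \<Longrightarrow>
      \<phi> (insert i K) + \<phi> (insert j K) \<le> \<phi> K + \<phi> (insert i (insert j K))"
    and fin: "finite I" "finite J" and sub: "I \<subseteq> M" "J \<subseteq> M" and disj: "I \<inter> J = {}"
  shows "\<phi> I + \<phi> J \<le> \<phi> {} + \<phi> (I \<union> J)"
proof -
  have row: "\<phi> (insert i K) + \<phi> (K \<union> J) \<le> \<phi> K + \<phi> (insert i (K \<union> J))"
    if "i \<in> M" "i \<notin> K" "K \<subseteq> M" "i \<notin> J" "J \<subseteq> M" "K \<inter> J = {}" "finite J" for i K J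
    using that(7,4-6)
  proof (induction J rule: finite_induct)
    case empty
    then show ?case by (simp add: add.commute)
  next
    case (insert j J)
    have "\<phi> (insert i K) + \<phi> (K \<union> J) \<le> \<phi> K + \<phi> (insert i (K \<union> J))"
      using insert by auto
    moreover have "\<phi> (insert i (K \<union> J)) + \<phi> (insert j (K \<union> J))
        \<le> \<phi> (K \<union> J) + \<phi> (insert i (insert j (K \<union> J)))"
      using insert that(1-3) by (intro loc) auto
    ultimately have "(\<phi> (insert i K) + \<phi> (K \<union> J)) + (\<phi> (insert i (K \<union> J)) + \<phi> (insert j (K \<union> J)))
        \<le> (\<phi> K + \<phi> (insert i (K \<union> J))) + (\<phi> (K \<union> J) + \<phi> (insert i (insert j (K \<union> J))))"
      by (rule add_mono)
    then show ?case
      by (simp add: algebra_simps)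
  qed
  show ?thesis
    using fin(1) sub(1) disj
  proof (induction I rule: finite_induct)
    case empty
    then show ?case by simp
  next
    case (insert i I)
    have "\<phi> I + \<phi> J \<le> \<phi> {} + \<phi> (I \<union> J)"
      using insert by auto
    moreover have "\<phi> (insert i I) + \<phi> (I \<union> J) \<le> \<phi> I + \<phi> (insert i (I \<union> J))"
      using insert fin(2) sub(2) by (intro row) auto
    ultimately have "(\<phi> I + \<phi> J) + (\<phi> (insert i I) + \<phi> (I \<union> J))
        \<le> (\<phi> {} + \<phi> (I \<union> J)) + (\<phi> I + \<phi> (insert i (I \<union> J)))"
      by (rule add_mono)
    then show ?case
      by (simp add: algebra_simps)
  qed
qed

text \<open>
  If \<open>f x + f y\<close> is finite, the midpoint inequality makes \<open>f\<close> finite at both rounded midpoints, so the inequality already implies that the effective domain is discrete midpoint convex.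
\<close>

lemma globally_imp_locally_discrete_midpoint_convex:
  fixes f :: "int ^ 'n \<Rightarrow> ereal"
  assumes fin: "\<And>z. f z \<noteq> - \<infinity>" and glob: "globally_discrete_midpoint_convex f"
  shows "locally_discrete_midpoint_convex f"
  unfolding locally_discrete_midpoint_convex_def discrete_midpoint_convex_set_def
proof (intro conjI ballI impI allI)
  fix x y
  assume xy: "x \<in> eff_dom f" "y \<in> eff_dom f" "linf_norm (x - y) \<ge> 2"
  let ?c = "vec_ceiling (midpoint (real_vec x) (real_vec y))"
  let ?e = "vec_floor (midpoint (real_vec x) (real_vec y))"
  have "f ?c + f ?e \<le> f x + f y"
    using glob xy(3)
    unfolding globally_discrete_midpoint_convex_def discrete_midpoint_ineq_def by blast
  also have "\<dots> < \<infinity>"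
    using xy(1,2) by (simp add: eff_dom_def)
  finally show "?c \<in> eff_dom f" "?e \<in> eff_dom f"
    using fin[of ?c] fin[of ?e] by (auto simp: eff_dom_def)
next
  fix x y :: "int ^ 'n"
  assume "linf_norm (x - y) = 2"
  then have "linf_norm (x - y) \<ge> 2"
    by linarith
  then show "discrete_midpoint_ineq f x y"
    using glob unfolding globally_discrete_midpoint_convex_def by blast
qed

lemma (in signed_chain) square_inequality:
  assumes f: "locally_discrete_midpoint_convex f" and ij: "i \<in> M" "j \<in> M" "i < j"
  shows "f (x + (char_vec (A i) - char_vec (B i))) + f (x + (char_vec (A j) - char_vec (B j)))
    \<le> f x + f (x + ((char_vec (A i) - char_vec (B i)) + (char_vec (A j) - char_vec (B j))))"
proof -
  let ?d = "\<lambda>k. char_vec (A k) - char_vec (B k)"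
  have nest: "A i \<subseteq> A j" "B j \<subseteq> B i" "A j \<inter> B i = {}"
    using A_mono B_antimono disjoint ij by auto
  interpret N: signed_chain "{i, j}" A B c
    using ij by (intro signed_chain_subset) auto
  have "linf_norm (?d i + ?d j) = 2"
    using N.linf_norm_signed_sum ij(3) by (simp add: signed_sum_def)
  then have "linf_norm (x - (x + (?d i + ?d j))) = 2"
    using linf_norm_minus[of "?d i + ?d j"] by (simp add: algebra_simps)
  then have "discrete_midpoint_ineq f x (x + (?d i + ?d j))"
    using f by (simp add: locally_discrete_midpoint_convex_def)
  moreover have "half_up (?d i + ?d j) = ?d j"
    using nest by (auto simp: half_up_def char_vec_def vec_eq_iff indicator_def)
  moreover have "half_down (?d i + ?d j) = ?d i"
    using nest by (auto simp: half_down_def char_vec_def vec_eq_iff indicator_def)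
  ultimately show ?thesis
    unfolding discrete_midpoint_ineq_def vec_ceiling_midpoint vec_floor_midpoint
    by (simp add: add.commute)
qed

text \<open>
  If \<open>f\<close> is infinite at the far corner, there is nothing to prove. Otherwise it is finite at all
  partial sums, and passing to real values makes the cancellation in \<open>supermodular_of_local\<close>
  available.
\<close>

lemma (in signed_chain) parallelogram_inequality:
  assumes ninf: "\<And>z. f z \<noteq> - \<infinity>" and f: "locally_discrete_midpoint_convex f"
    and x: "x \<in> eff_dom f" and IJ: "I \<inter> J = {}" "I \<union> J = M"
  shows "f (x + signed_sum A B I) + f (x + signed_sum A B J) \<le> f x + f (x + signed_sum A B M)"
proof (cases "x + signed_sum A B M \<in> eff_dom f")
  case False
  then show ?thesis
    using ninf[of x] by (simp add: eff_dom_def)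
next
  case True
  have "discrete_midpoint_convex_set (eff_dom f)"
    using f by (simp add: locally_discrete_midpoint_convex_def)
  note mem = partial_signed_sum_mem[OF this x True]
  define \<phi> where "\<phi> K = real_of_ereal (f (x + signed_sum A B K))" for K
  have \<phi>: "f (x + signed_sum A B K) = ereal (\<phi> K)" if "K \<subseteq> M" for K
    using mem[OF that] ninf[of "x + signed_sum A B K"] unfolding \<phi>_def eff_dom_def
    by (cases "f (x + signed_sum A B K)") auto
  have less: "\<phi> (insert i K) + \<phi> (insert j K) \<le> \<phi> K + \<phi> (insert i (insert j K))"
    if K: "K \<subseteq> M" "i \<in> M - K" "j \<in> M - K" "i < j" for K i j
  proof -
    have "finite K"
      using K(1) finite_M finite_subset by blast
    then have "ereal (\<phi> (insert i K)) + ereal (\<phi> (insert j K))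
        \<le> ereal (\<phi> K) + ereal (\<phi> (insert i (insert j K)))"
      using square_inequality[OF f, of i j "x + signed_sum A B K"] K
      by (simp add: \<phi>[symmetric] signed_sum_insert algebra_simps)
    then show ?thesis
      by simp
  qed
  have "\<phi> I + \<phi> J \<le> \<phi> {} + \<phi> (I \<union> J)"
  proof (rule supermodular_of_local[where M = M])
    fix K i j
    assume K: "K \<subseteq> M" "i \<in> M - K" "j \<in> M - K" "i \<noteq> j"
    then consider "i < j" | "j < i"
      by linarith
    then show "\<phi> (insert i K) + \<phi> (insert j K) \<le> \<phi> K + \<phi> (insert i (insert j K))"
    proof cases
      case 1
      with K show ?thesis by (intro less)
    next
      case 2
      with K less[of K j i] show ?thesis
        by (simp add: insert_commute add.commute)
    qed
  qed (use IJ finite_M in auto)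
  then have "ereal (\<phi> I) + ereal (\<phi> J) \<le> ereal (\<phi> {}) + ereal (\<phi> M)"
    using IJ(2) by simp
  moreover have "I \<subseteq> M" "J \<subseteq> M"
    using IJ by auto
  moreover have "signed_sum A B {} = 0"
    by (simp add: signed_sum_def)
  ultimately show ?thesis
    using \<phi>[of I] \<phi>[of J] \<phi>[of "{}"] \<phi>[of M] by simp
qed

theorem theorem3p1:
  fixes f :: "int ^ 'n \<Rightarrow> ereal" and x :: "int ^ 'n"
    and m :: nat and A B :: "nat \<Rightarrow> 'n set" and I J :: "nat set"
  assumes "\<And>z. f z \<noteq> - \<infinity>"
    and "locally_discrete_midpoint_convex f \<or> globally_discrete_midpoint_convex f"
    and "x \<in> eff_dom f"
    and "m \<ge> 1"
    and "mono_on {1..m} A"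
    and "antimono_on {1..m} B"
    and "A m \<inter> B 1 = {}"
    and "A 1 \<union> B m \<noteq> {}"
    and "I \<inter> J = {}" and "I \<union> J = {1..m}"
  shows "let d1 = (\<Sum>i\<in>I. char_vec (A i) - char_vec (B i));
             d2 = (\<Sum>j\<in>J. char_vec (A j) - char_vec (B j))
         in f x + f (x + d1 + d2) \<ge> f (x + d1) + f (x + d2)"
proof -
  have mono: "A k \<subseteq> A l" if "k \<in> {1..m}" "l \<in> {1..m}" "k \<le> l" for k l
    using assms(5) that by (auto simp: monotone_on_def)
  have anti: "B l \<subseteq> B k" if "k \<in> {1..m}" "l \<in> {1..m}" "k \<le> l" for k l
    using assms(6) that by (auto simp: monotone_on_def)
  obtain c where c: "c \<in> A 1 \<union> B m"
    using assms(8) by blast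
  have ends: "A 1 \<subseteq> A k" "A k \<subseteq> A m" "B m \<subseteq> B k" "B k \<subseteq> B 1" if "k \<in> {1..m}" for k
    using that assms(4) mono[of 1 k] mono[of k m] anti[of k m] anti[of 1 k] by simp_all
  interpret signed_chain "{1..m}" A B c
  proof
    fix k l
    assume "k \<in> {1..m}" "l \<in> {1..m}"
    then show "A k \<inter> B l = {}"
      using ends(2)[of k] ends(4)[of l] assms(7) by blast
  next
    show "(\<forall>k\<in>{1..m}. c \<in> A k) \<or> (\<forall>k\<in>{1..m}. c \<in> B k)"
      using c ends(1,3) by blast
  qed (use mono anti in auto)
  have "locally_discrete_midpoint_convex f"
    using assms(1,2) globally_imp_locally_discrete_midpoint_convex by blast
  then have "f (x + signed_sum A B I) + f (x + signed_sum A B J)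
      \<le> f x + f (x + signed_sum A B {1..m})"
    using assms(1,3,9,10) by (intro parallelogram_inequality)
  moreover have "finite I" "finite J"
    using assms(10) by (metis finite_Un finite_atLeastAtMost)+
  then have "signed_sum A B {1..m} = signed_sum A B I + signed_sum A B J"
    unfolding signed_sum_def assms(10)[symmetric]
    using assms(9) by (rule sum.union_disjoint)
  ultimately show ?thesis
    by (simp add: signed_sum_def Let_def add.assoc)
qed

end
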